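(* Let $M\ge0$, $N\ge0$ be integers with $M+N\ge1$. Let $X_1,\ldots,X_M,Y_1,\ldots,Y_N$ be independent random variables with $X_i\sim N(0,\sigma_{X_i}^2)$ and $Y_j\sim N(0,\sigma_{Y_j}^2)$, and let $Z=X/Y$ with $X=X_1\cdots X_M$ and $Y=Y_1\cdots Y_N$. Then, for $-1<r<1$, $$\mathbb{E}[|Z|^r]=\frac{2^{(M-N)r/2}\sigma_M^r}{\pi^{(M+N)/2}s_N^r}\bigg(\Gamma\Big(\frac{r+1}{2}\Big)\bigg)^M\bigg(\Gamma\Big(\frac{1-r}{2}\Big)\bigg)^N.$$ When $M\ge1$ and $N=0$, this equation holds for all $r>-1$, whilst when $M=0$ and $N\ge1$, it holds for all $r<1$.
   Context: All standard deviations $\sigma_{X_i},\sigma_{Y_j}$ are positive. Notation: $\sigma_M=\sigma_{X_1}\cdots\sigma_{X_M}$ and $s_N=\sigma_{Y_1}\cdots\sigma_{Y_N}$. Empty products are $1$: thus $\sigma_0=1$, $s_0=1$, $X=1$ when $M=0$, and $Y=1$ when $N=0$. A factor raised to the power $0$ (i.e. when $M=0$ or $N=0$) is an empty product, equal to $1$, even where the gamma function in it is undefined. *)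

theory Defs
  imports "HOL-Probability.Probability"
begin

end

theory Submission imports Defs begin

text \<open>
  Since \<open>\<bar>X / Y\<bar> powr r\<close> is the product of the independent factors \<open>\<bar>X\<^sub>i\<bar> powr r\<close>
  and \<open>\<bar>Y\<^sub>j\<bar> powr (- r)\<close>, the expectation is a product of absolute moments of single
  Gaussians. Each of these is reduced to the Gamma integral by substituting
  \<open>t = x\<^sup>2 / (2 * \<sigma>\<^sup>2)\<close>; it is finite for exponents greater than \<open>-1\<close>.
\<close>

text \<open>Change of variables \<open>t = x\<^sup>2 / c\<close> in Euler's integral for
  \<open>Gamma s\<close>; the factor \<open>2 * x / c\<close> is the Jacobian. On the open half-line
  it is positive and the map is a bijection onto the same half-line.\<close>

lemma Gamma_set_integral_square_substitution:
  fixes s c :: real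
  assumes s: "0 < s" and c: "0 < c"
  shows "(\<lambda>x. (2 * x / c) * ((x\<^sup>2 / c) powr (s - 1) / exp (x\<^sup>2 / c)))
           absolutely_integrable_on {0<..}" (is "?f absolutely_integrable_on _")
    and "integral {0<..} (\<lambda>x. (2 * x / c) * ((x\<^sup>2 / c) powr (s - 1) / exp (x\<^sup>2 / c))) = Gamma s"
proof -
  let ?g = "\<lambda>x::real. x\<^sup>2 / c" and ?h = "\<lambda>t. t powr (s - 1) / exp t"
  have "(?h has_integral Gamma s) {0..}"
    using Gamma_integral_real[OF s] .
  \<comment> \<open>The endpoint 0 is a null set, so Euler's integral may be restricted to the open
    half-line.\<close>
  then have "((\<lambda>t. if t \<in> {0<..} then ?h t else 0) has_integral Gamma s) {0..}"
    by (rule has_integral_spike[of "{0}", rotated 2]) auto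
  then have Gamma: "(?h has_integral Gamma s) {0<..}"
    by (subst (asm) has_integral_restrict) auto
  have "?g ` {0<..} = {0<..}"
  proof (intro equalityI subsetI)
    fix t :: real assume "t \<in> {0<..}"
    then show "t \<in> ?g ` {0<..}"
      using c by (intro image_eqI[of _ _ "sqrt (c * t)"]) auto
  qed (use c in auto)
  moreover have "?h absolutely_integrable_on {0<..}"
    using Gamma by (subst absolutely_integrable_on_iff_nonneg) auto
  ultimately have h: "?h absolutely_integrable_on ?g ` {0<..} \<and> integral (?g ` {0<..}) ?h = Gamma s"
    using Gamma by (simp add: integral_unique)
  have inj: "inj_on ?g {0<..}"
    using c by (auto simp: inj_on_def)
  have deriv: "(?g has_field_derivative 2 * x / c) (at x within {0<..})" for x
    using c by (auto intro!: derivative_eq_intros)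
  have "(\<lambda>x. \<bar>2 * x / c\<bar> * ?h (?g x)) absolutely_integrable_on {0<..} \<and>
      integral {0<..} (\<lambda>x. \<bar>2 * x / c\<bar> * ?h (?g x)) = Gamma s"
    using has_absolute_integral_change_of_variables_1'[OF _ deriv inj, of ?h "Gamma s"] h by simp
  moreover have "\<bar>2 * x / c\<bar> * ?h (?g x) = ?f x" if "x \<in> {0<..}" for x
    using that c by simp
  ultimately show "?f absolutely_integrable_on {0<..}" "integral {0<..} ?f = Gamma s"
    using set_integrable_cong[OF refl refl, of "{0<..}" "\<lambda>x. \<bar>2 * x / c\<bar> * ?h (?g x)" ?f lebesgue]
      Henstock_Kurzweil_Integration.integral_cong[of "{0<..}" "\<lambda>x. \<bar>2 * x / c\<bar> * ?h (?g x)" ?f]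
    by (simp_all)
qed

text \<open>With \<open>c = 2 * \<sigma>\<^sup>2\<close> and \<open>s = (p + 1) / 2\<close>, the
  substituted integrand is a multiple of \<open>x powr (1 + 2 * (s - 1)) = x powr p\<close> times
  the Gaussian exponential, and \<open>p > -1\<close> is exactly \<open>s > 0\<close>. This covers
  the positive half-line; evenness gives the rest.\<close>

lemma normal_abs_moment_powr:
  fixes \<sigma> p :: real
  assumes \<sigma>: "0 < \<sigma>" and p: "- 1 < p"
  shows "has_bochner_integral lborel (\<lambda>x. normal_density 0 \<sigma> x * \<bar>x\<bar> powr p)
           (2 powr (p / 2) * \<sigma> powr p * Gamma ((p + 1) / 2) / sqrt pi)"
proof -
  define c where "c = 2 * \<sigma>\<^sup>2"
  define s where "s = (p + 1) / 2"
  \<comment> \<open>Half of the constant in front of Gamma in the claim, since \<open>f\<close> only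
    sees the positive half-line.\<close>
  define K where "K = 2 powr (p / 2) * \<sigma> powr p / (2 * sqrt pi)"
  define f where "f x = (2 * x / c) * ((x\<^sup>2 / c) powr (s - 1) / exp (x\<^sup>2 / c))" for x
  have c: "0 < c" and s: "0 < s"
    using \<sigma> p by (auto simp: c_def s_def)
  have [measurable]: "f \<in> borel_measurable borel"
    unfolding f_def by measurable
  have f: "f absolutely_integrable_on {0<..}" "integral {0<..} f = Gamma s"
    using Gamma_set_integral_square_substitution[OF s c] by (simp_all add: f_def[abs_def])
  \<comment> \<open>Absolute integrability refers to \<open>lebesgue\<close>, the completion of
    \<open>lborel\<close>; Borel measurability of \<open>f\<close> brings it down to
    \<open>lborel\<close>.\<close>
  have "integrable lborel (\<lambda>x. indicator {0<..} x *\<^sub>R f x)"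
    using f(1) unfolding set_integrable_def by (subst (asm) integrable_completion) auto
  moreover have "(\<integral>x. indicator {0<..} x *\<^sub>R f x \<partial>lborel) = Gamma s"
    using set_lebesgue_integral_eq_integral(2)[OF f(1)] f(2)
    unfolding set_lebesgue_integral_def by (subst (asm) integral_completion) auto
  ultimately have "has_bochner_integral lborel (\<lambda>x. indicator {0<..} x *\<^sub>R f x) (Gamma s)"
    by (simp add: has_bochner_integral_iff)
  then have "has_bochner_integral lborel (\<lambda>x. K * (indicator {0<..} x *\<^sub>R f x)) (K * Gamma s)"
    by (rule has_bochner_integral_mult_right)
  \<comment> \<open>The closed half-line is the form that the even-function rule expects. At
    \<open>x = 0\<close> both sides vanish, because \<open>0 powr p = 0\<close> for every
    \<open>p\<close>.\<close>
  also have "(\<lambda>x. K * (indicator {0<..} x *\<^sub>R f x)) =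
      (\<lambda>x. indicator {0..} x *\<^sub>R (normal_density 0 \<sigma> x * \<bar>x\<bar> powr p))"
  proof
    fix x :: real
    have "K * f x = normal_density 0 \<sigma> x * \<bar>x\<bar> powr p" if x: "0 < x"
    proof -
      have "x\<^sup>2 / c = (x / (sqrt 2 * \<sigma>)) powr 2"
        using x \<sigma> by (simp add: c_def power_divide power_mult_distrib)
      then have "(x\<^sup>2 / c) powr (s - 1) = (x / (sqrt 2 * \<sigma>)) powr (p - 1)"
        using s_def by (simp add: powr_powr diff_divide_distrib add_divide_distrib right_diff_distrib)
      also have "\<dots> = x powr p / x * (sqrt 2 * \<sigma>) / (2 powr (p / 2) * \<sigma> powr p)"
        using x \<sigma> by (simp add: powr_divide powr_mult powr_diff powr_powr field_simps
            flip: powr_half_sqrt)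
      finally have powr_eq: "(x\<^sup>2 / c) powr (s - 1) =
          x powr p / x * (sqrt 2 * \<sigma>) / (2 powr (p / 2) * \<sigma> powr p)" .
      have "K * f x = K * (2 * x / c) *
          (x powr p / x * (sqrt 2 * \<sigma>) / (2 powr (p / 2) * \<sigma> powr p)) * exp (- (x\<^sup>2 / c))"
        unfolding f_def powr_eq exp_minus by (simp only: divide_inverse mult.assoc)
      also have "\<dots> = 1 / (sqrt pi * sqrt 2 * \<sigma>) * exp (- (x\<^sup>2 / c)) * x powr p"
      proof -
        \<comment> \<open>Purely algebraic identity, to be used with
          \<open>a = 2 powr (p / 2) * \<sigma> powr p\<close>, \<open>b = x powr p\<close>,
          \<open>w = sqrt pi\<close>, \<open>v = sqrt 2\<close> and \<open>e\<close> the
          exponential; \<open>v\<^sup>2 = 2\<close> turns \<open>c\<close> into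
          \<open>v * v * \<sigma> * \<sigma>\<close>.\<close>
        have "a / (2 * w) * (2 * x / c) * (b / x * (v * \<sigma>) / a) * e =
            1 / (w * v * \<sigma>) * e * b" if "a \<noteq> 0" "w \<noteq> 0" "v\<^sup>2 = 2" for a b e v w :: real
        proof -
          have "v \<noteq> 0" "c = v * v * \<sigma> * \<sigma>"
            using that(3) by (auto simp: c_def power2_eq_square)
          then show ?thesis
            using that(1,2) x \<sigma> by (simp add: mult.commute mult.left_commute)
        qed
        then show ?thesis
          unfolding K_def by this (use \<sigma> in auto)
      qed
      also have "\<dots> = normal_density 0 \<sigma> x * \<bar>x\<bar> powr p"
        using x \<sigma> by (simp add: normal_density_def c_def real_sqrt_mult)
      finally show ?thesis .
    qed
    then show "K * (indicator {0<..} x *\<^sub>R f x) =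
        indicator {0..} x *\<^sub>R (normal_density 0 \<sigma> x * \<bar>x\<bar> powr p)"
      by (cases x "0::real" rule: linorder_cases) (auto simp: indicator_def)
  qed
  finally have "has_bochner_integral lborel (\<lambda>x. normal_density 0 \<sigma> x * \<bar>x\<bar> powr p)
      (2 *\<^sub>R (K * Gamma s))"
    by (rule has_bochner_integral_even_function) (simp add: normal_density_def)
  then show ?thesis
    by (simp add: K_def s_def)
qed

lemma distributed_normal_abs_moment_powr:
  fixes \<sigma> p :: real
  assumes X: "distributed P lborel X (normal_density 0 \<sigma>)" and \<sigma>: "0 < \<sigma>" and p: "- 1 < p"
  shows "has_bochner_integral P (\<lambda>\<omega>. \<bar>X \<omega>\<bar> powr p)
           (2 powr (p / 2) * \<sigma> powr p * Gamma ((p + 1) / 2) / sqrt pi)"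
  using normal_abs_moment_powr[OF \<sigma> p]
    distributed_integrable[OF X, of "\<lambda>x. \<bar>x\<bar> powr p"]
    distributed_integral[OF X, of "\<lambda>x. \<bar>x\<bar> powr p"]
  by (simp add: has_bochner_integral_iff)

theorem proposition2p11:
  fixes P :: "'a measure"
    and M N :: nat
    and X Y :: "nat \<Rightarrow> 'a \<Rightarrow> real"
    and \<sigma>X \<sigma>Y :: "nat \<Rightarrow> real"
    and r :: real
  assumes "prob_space P"
    and "M + N \<ge> 1"
    and "\<And>i. i \<in> {1..M} \<Longrightarrow> \<sigma>X i > 0"
    and "\<And>j. j \<in> {1..N} \<Longrightarrow> \<sigma>Y j > 0"
    and "\<And>i. i \<in> {1..M} \<Longrightarrow> distributed P lborel (X i) (normal_density 0 (\<sigma>X i))"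
    and "\<And>j. j \<in> {1..N} \<Longrightarrow> distributed P lborel (Y j) (normal_density 0 (\<sigma>Y j))"
    and "prob_space.indep_vars P (\<lambda>_. borel)
           (\<lambda>k. case k of Inl i \<Rightarrow> X i | Inr j \<Rightarrow> Y j) ({1..M} <+> {1..N})"
    and "(-1 < r \<and> r < 1) \<or> (M \<ge> 1 \<and> N = 0 \<and> -1 < r) \<or> (M = 0 \<and> N \<ge> 1 \<and> r < 1)"
  shows "integrable P (\<lambda>\<omega>. \<bar>(\<Prod>i=1..M. X i \<omega>) / (\<Prod>j=1..N. Y j \<omega>)\<bar> powr r) \<and>
         prob_space.expectation P (\<lambda>\<omega>. \<bar>(\<Prod>i=1..M. X i \<omega>) / (\<Prod>j=1..N. Y j \<omega>)\<bar> powr r) =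
           (2 powr ((real M - real N) * r / 2) * (\<Prod>i=1..M. \<sigma>X i) powr r)
             / (pi powr ((real M + real N) / 2) * (\<Prod>j=1..N. \<sigma>Y j) powr r)
           * Gamma ((r + 1) / 2) ^ M * Gamma ((1 - r) / 2) ^ N"
proof -
  interpret prob_space P by fact
  \<comment> \<open>One family over the disjoint sum of the index sets: with exponent
    \<open>q k\<close>, equal to \<open>r\<close> or \<open>- r\<close>, numerator and denominator
    factors are treated alike.\<close>
  define I where "I = ({1..M} <+> {1..N})"
  define W where "W k = (case k of Inl i \<Rightarrow> X i | Inr j \<Rightarrow> Y j)" for k
  define \<tau> where "\<tau> k = (case k of Inl i \<Rightarrow> \<sigma>X i | Inr j \<Rightarrow> \<sigma>Y j)" for k
  define q where "q k = (case k of Inl (i::nat) \<Rightarrow> r | Inr (j::nat) \<Rightarrow> - r)" for k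
  define m where "m k = 2 powr (q k / 2) * \<tau> k powr q k * Gamma ((q k + 1) / 2) / sqrt pi" for k
  have prod_I: "(\<Prod>k\<in>I. f k) = (\<Prod>i=1..M. f (Inl i)) * (\<Prod>j=1..N. f (Inr j))"
    for f :: "nat + nat \<Rightarrow> real"
    by (simp add: I_def prod.Plus)
  have card_I: "card I = M + N"
    by (simp add: I_def card_Plus)
  \<comment> \<open>The bound \<open>-1 < q k\<close> means \<open>r > -1\<close> at an
    \<open>X\<close> index and \<open>r < 1\<close> at a \<open>Y\<close> index. If one family is
    empty, its bound is never called for, which gives the two extended ranges of
    \<open>r\<close>.\<close>
  have moment: "has_bochner_integral P (\<lambda>\<omega>. \<bar>W k \<omega>\<bar> powr q k) (m k)" if "k \<in> I" for k
    unfolding m_def using that assms(3-6,8)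
    by (intro distributed_normal_abs_moment_powr) (auto simp: I_def W_def \<tau>_def q_def)
  have fin: "finite I"
    by (simp add: I_def)
  have "indep_vars (\<lambda>_. borel) W I"
    using assms(7) by (simp add: I_def W_def[abs_def])
  then have indep: "indep_vars (\<lambda>_. borel) (\<lambda>k \<omega>. \<bar>W k \<omega>\<bar> powr q k) I"
    by (rule indep_vars_compose2) measurable
  have integrable_W: "integrable P (\<lambda>\<omega>. \<bar>W k \<omega>\<bar> powr q k)" if "k \<in> I" for k
    using moment[OF that] by (simp add: has_bochner_integral_iff)
  have "expectation (\<lambda>\<omega>. \<Prod>k\<in>I. \<bar>W k \<omega>\<bar> powr q k) =
      (\<Prod>k\<in>I. expectation (\<lambda>\<omega>. \<bar>W k \<omega>\<bar> powr q k))"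
    by (rule indep_vars_lebesgue_integral[OF fin indep integrable_W])
  also have "\<dots> = (\<Prod>k\<in>I. m k)"
    by (intro prod.cong refl has_bochner_integral_integral_eq moment)
  finally have E: "expectation (\<lambda>\<omega>. \<Prod>k\<in>I. \<bar>W k \<omega>\<bar> powr q k) = (\<Prod>k\<in>I. m k)" .
  \<comment> \<open>The equality holds at every point: where some factor is 0, both sides are 0, by
    \<open>inverse 0 = 0\<close> and \<open>0 powr r = 0\<close>.\<close>
  have Z: "(\<lambda>\<omega>. \<bar>(\<Prod>i=1..M. X i \<omega>) / (\<Prod>j=1..N. Y j \<omega>)\<bar> powr r) =
      (\<lambda>\<omega>. \<Prod>k\<in>I. \<bar>W k \<omega>\<bar> powr q k)"
  proof
    fix \<omega>
    define V where "V k = (case k of Inl i \<Rightarrow> \<bar>X i \<omega>\<bar> | Inr j \<Rightarrow> inverse \<bar>Y j \<omega>\<bar>)" for k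
    have "\<bar>(\<Prod>i=1..M. X i \<omega>) / (\<Prod>j=1..N. Y j \<omega>)\<bar> = (\<Prod>k\<in>I. V k)"
      by (simp add: prod_I V_def abs_mult abs_prod prod_inversef[unfolded o_def] divide_inverse)
    also have "\<dots> powr r = (\<Prod>k\<in>I. V k powr r)"
      by (rule prod_powr_distrib)
    also have "\<dots> = (\<Prod>k\<in>I. \<bar>W k \<omega>\<bar> powr q k)"
      by (intro prod.cong refl)
        (auto simp: V_def W_def q_def powr_minus inverse_powr split: sum.splits)
    finally show "\<bar>(\<Prod>i=1..M. X i \<omega>) / (\<Prod>j=1..N. Y j \<omega>)\<bar> powr r = \<dots>" .
  qed
  have \<sigma>X: "(\<Prod>i=1..M. \<sigma>X i powr r) = (\<Prod>i=1..M. \<sigma>X i) powr r"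
    by (rule prod_powr_distrib[symmetric])
  have \<sigma>Y: "(\<Prod>j=1..N. \<sigma>Y j powr - r) = inverse ((\<Prod>j=1..N. \<sigma>Y j) powr r)"
    by (simp add: powr_minus prod_powr_distrib prod_inversef[unfolded o_def])
  have two: "(2 powr (r / 2)) ^ M * (2 powr (- r / 2)) ^ N = 2 powr ((real M - real N) * r / 2)"
    by (simp add: powr_power algebra_simps diff_divide_distrib flip: powr_add)
  have pi: "sqrt pi ^ M * sqrt pi ^ N = pi powr ((real M + real N) / 2)"
    by (simp add: powr_power add_divide_distrib flip: powr_half_sqrt powr_add)
  \<comment> \<open>The \<open>M\<close> moments of exponent \<open>r\<close> and the
    \<open>N\<close> moments of exponent \<open>- r\<close> are collected. For \<open>M = 0\<close>
    or \<open>N = 0\<close> the matching Gamma factor has power 0 and equals 1, even at a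
    pole.\<close>
  have "(\<Prod>k\<in>I. m k) =
      ((2 powr (r / 2)) ^ M * (2 powr (- r / 2)) ^ N) * (\<Prod>i=1..M. \<sigma>X i powr r) *
      (\<Prod>j=1..N. \<sigma>Y j powr - r) * Gamma ((r + 1) / 2) ^ M * Gamma ((1 - r) / 2) ^ N /
      (sqrt pi ^ M * sqrt pi ^ N)"
    by (simp add: prod_I card_I power_add m_def q_def \<tau>_def prod.distrib prod_dividef mult_ac)
  also have "\<dots> = (2 powr ((real M - real N) * r / 2) * (\<Prod>i=1..M. \<sigma>X i) powr r)
             / (pi powr ((real M + real N) / 2) * (\<Prod>j=1..N. \<sigma>Y j) powr r)
           * Gamma ((r + 1) / 2) ^ M * Gamma ((1 - r) / 2) ^ N"
    unfolding two pi \<sigma>X \<sigma>Y by (simp only: divide_inverse inverse_mult_distrib mult_ac)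
  finally have "(\<Prod>k\<in>I. m k) = \<dots>" .
  then show ?thesis
    using indep_vars_integrable[OF fin indep integrable_W] E unfolding Z by simp
qed

end
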